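(* Let $\mathscr{A}=\{\boldsymbol{\alpha}_1,\ldots,\boldsymbol{\alpha}_m\}\subseteq\mathbb{R}^{m-1}$ be a trellis and let $\boldsymbol{\beta}=\sum_{i=1}^m\frac{s_i}{\hat{s}}\boldsymbol{\alpha}_i$, where $s_1,\ldots,s_m$ are positive integers with $\gcd(s_1,\ldots,s_m)=1$ and $\hat{s}=\sum_{i=1}^m s_i$. Then for any $(\mathscr{A},\boldsymbol{\beta})$-mediated set $\mathscr{B}$, one has $|\mathscr{B}|\ge\lceil\log_2(\hat{s})\rceil$.
   Context: A set of $m$ points $\mathscr{A}=\{\boldsymbol{\alpha}_1,\ldots,\boldsymbol{\alpha}_m\}\subseteq\mathbb{R}^{m-1}$ is called a trellis if the points are affinely independent. Given a trellis $\mathscr{A}$, a set of points $\mathscr{B}\subseteq\mathbb{R}^{m-1}$ is an $\mathscr{A}$-mediated set if every point of $\mathscr{B}$ is the average (midpoint) of two distinct points of $\mathscr{A}\cup\mathscr{B}$. For a point $\boldsymbol{\beta}$ in the relative interior of the convex hull of $\mathscr{A}$, an $(\mathscr{A},\boldsymbol{\beta})$-mediated set is an $\mathscr{A}$-mediated set containing $\boldsymbol{\beta}$. $|\mathscr{B}|$ is the cardinality of $\mathscr{B}$, and $\lceil a\rceil$ is the least integer not smaller than $a$. *)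

theory Defs
  imports "HOL-Analysis.Analysis"
begin

text \<open>
  A type of class \<open>euclidean_space\<close> has dimension at least 1, so it cannot represent the space
  of dimension 0 in which a trellis with a single point lives. The ambient space of a trellis is
  therefore a linear subspace \<open>V\<close>; the choice \<open>V = UNIV\<close> gives the whole Euclidean space.
\<close>

definition trellis :: "'a::euclidean_space set \<Rightarrow> 'a set \<Rightarrow> bool" where
  "trellis V A \<longleftrightarrow>
     subspace V \<and> A \<subseteq> V \<and> finite A \<and> card A = dim V + 1 \<and> \<not> affine_dependent A"

definition mediated_set :: "'a::euclidean_space set \<Rightarrow> 'a set \<Rightarrow> 'a set \<Rightarrow> bool" where
  "mediated_set V A B \<longleftrightarrow>
     B \<subseteq> V \<and> (\<forall>b\<in>B. \<exists>x\<in>A \<union> B. \<exists>y\<in>A \<union> B. x \<noteq> y \<and> b = midpoint x y)"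

definition point_mediated_set :: "'a::euclidean_space set \<Rightarrow> 'a set \<Rightarrow> 'a \<Rightarrow> 'a set \<Rightarrow> bool" where
  "point_mediated_set V A \<beta> B \<longleftrightarrow>
     \<beta> \<in> rel_interior (convex hull A) \<and> mediated_set V A B \<and> \<beta> \<in> B"

end

theory Submission
  imports Defs "HOL-Library.Multiset"
begin

text \<open>
  Let \<open>A\<close> be the trellis, \<open>B\<close> finite and \<open>n = card B\<close>. Affine independence of \<open>A\<close> and coprimality of the \<open>s i\<close>
  make \<open>s_hat\<close> the order of \<open>\<beta>\<close> modulo the group generated by \<open>A\<close>, provided that only integer
  combinations with \<open>(\<Sum>a\<in>A. c a *\<^sub>R a) = k *\<^sub>R \<beta>\<close> and \<open>(\<Sum>a\<in>A. c a) = k\<close> are admitted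
  (\<open>integer_affine_representation_dvd\<close>). Hence it suffices to show that the multiples
  \<open>k *\<^sub>R \<beta>\<close> fall into at most \<open>2 ^ n\<close> classes.

  This is a chip-firing argument. Put \<open>k\<close> chips on \<open>\<beta>\<close>. Whenever a point \<open>b\<close> of \<open>B\<close> carries two
  chips, write \<open>b\<close> as the midpoint of distinct points \<open>x\<close> and \<open>y\<close> of \<open>A \<union> B\<close> and move one of the
  chips to \<open>x\<close>, the other to \<open>y\<close>. A move changes neither the number of chips nor the sum of their
  positions, and by strict convexity of the squared norm it increases the moment of inertia. So
  the process stops at a configuration with at most one chip on each point of \<open>B\<close>
  (\<open>stable_configuration_exists\<close>). Modulo \<open>A\<close>, such a configuration is a subset of \<open>B\<close>. Different
  \<open>k < s_hat\<close> must give different subsets, because the difference of two configurations that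
  agree on \<open>B\<close> is an integer combination of \<open>A\<close>; thus \<open>s_hat \<le> 2 ^ n\<close>.
\<close>

lemma finite_multisets_of_size_within:
  assumes "finite P"
  shows "finite {M. set_mset M \<subseteq> P \<and> size M = k}"
proof (rule finite_subset)
  show "{M. set_mset M \<subseteq> P \<and> size M = k} \<subseteq> mset ` {xs. set xs \<subseteq> P \<and> length xs = k}"
  proof
    fix M assume "M \<in> {M. set_mset M \<subseteq> P \<and> size M = k}"
    moreover obtain xs where "mset xs = M" using ex_mset by blast
    ultimately show "M \<in> mset ` {xs. set xs \<subseteq> P \<and> length xs = k}" by force
  qed
  show "finite (mset ` {xs. set xs \<subseteq> P \<and> length xs = k})"
    using assms by (simp add: finite_lists_length_eq)
qed

lemma sum_mset_scaleR_count:
  fixes N :: "'a::real_vector multiset"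
  assumes "finite A" "set_mset N \<subseteq> A"
  shows "\<Sum>\<^sub># N = (\<Sum>a\<in>A. real (count N a) *\<^sub>R a)"
  using assms(2)
proof (induction N)
  case (add x N)
  have "(\<Sum>a\<in>A. real (count (add_mset x N) a) *\<^sub>R a)
      = (\<Sum>a\<in>A. real (count N a) *\<^sub>R a + (if a = x then x else 0))"
    by (rule sum.cong) (auto simp: algebra_simps)
  also have "\<dots> = \<Sum>\<^sub># N + x"
    using add assms(1) by (simp add: sum.distrib)
  finally show ?case by simp
qed simp

lemma size_eq_sum_count:
  assumes "finite A" "set_mset N \<subseteq> A"
  shows "size N = (\<Sum>a\<in>A. count N a)"
  unfolding size_multiset_overloaded_eq
  using assms by (intro sum.mono_neutral_left) (auto simp: not_in_iff)

lemma midpoint_inner_self_less: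
  fixes x y :: "'a::real_inner"
  assumes "x \<noteq> y"
  shows "2 * (midpoint x y \<bullet> midpoint x y) < x \<bullet> x + y \<bullet> y"
proof -
  have "0 < (x - y) \<bullet> (x - y)" using assms by simp
  then show ?thesis
    by (simp add: midpoint_def inner_simps inner_commute[of y x] field_simps)
qed

text \<open>
  Only finitely many configurations have \<open>k\<close> chips, so one of them maximizes the moment of inertia
  among those with the required sum. It is stable, since firing would increase the moment.
\<close>

lemma stable_configuration_exists:
  fixes A B :: "'a::real_inner set"
  assumes "finite A" "finite B"
    and mid: "\<forall>b\<in>B. \<exists>x\<in>A \<union> B. \<exists>y\<in>A \<union> B. x \<noteq> y \<and> b = midpoint x y"
    and "\<beta> \<in> A \<union> B"
  shows "\<exists>M. set_mset M \<subseteq> A \<union> B \<and> size M = k \<and> \<Sum>\<^sub># M = real k *\<^sub>R \<beta> \<and> (\<forall>b\<in>B. count M b \<le> 1)"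
proof -
  define C where "C = {M. set_mset M \<subseteq> A \<union> B \<and> size M = k \<and> \<Sum>\<^sub># M = real k *\<^sub>R \<beta>}"
  define inertia :: "'a multiset \<Rightarrow> real" where "inertia M = (\<Sum>p\<in>#M. p \<bullet> p)" for M
  have "finite C"
    by (rule finite_subset[OF _ finite_multisets_of_size_within[of "A \<union> B" k]])
       (use assms in \<open>auto simp: C_def\<close>)
  moreover have "\<Sum>\<^sub># (replicate_mset j \<beta>) = real j *\<^sub>R \<beta>" for j
    by (induction j) (simp_all add: algebra_simps)
  then have "replicate_mset k \<beta> \<in> C"
    using assms(4) by (auto simp: C_def split: if_splits)
  ultimately have "Max (inertia ` C) \<in> inertia ` C"
    by (intro Max_in) auto
  then obtain M where M: "M \<in> C" and M_max: "inertia M = Max (inertia ` C)"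
    by auto
  have max: "inertia N \<le> inertia M" if "N \<in> C" for N
    using \<open>finite C\<close> that by (simp add: M_max)
  have "count M b \<le> 1" if "b \<in> B" for b
  proof (rule ccontr)
    assume "\<not> count M b \<le> 1"
    then have "replicate_mset 2 b \<subseteq># M"
      by (simp add: count_le_replicate_mset_subset_eq[symmetric])
    then obtain N where N: "M = {#b, b#} + N"
      by (auto simp: numeral_2_eq_2 mset_subset_eq_exists_conv)
    from mid that obtain x y where xy: "x \<in> A \<union> B" "y \<in> A \<union> B" "x \<noteq> y" "b = midpoint x y"
      by blast
    have "x + y = b + b"
      by (simp add: xy(4))
    then have "\<Sum>\<^sub># ({#x, y#} + N) = \<Sum>\<^sub># M"
      unfolding N by (simp flip: add.assoc)
    moreover have "set_mset ({#x, y#} + N) \<subseteq> A \<union> B" "size ({#x, y#} + N) = k"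
      using M xy(1,2) by (auto simp: C_def N)
    ultimately have "{#x, y#} + N \<in> C"
      using M by (simp only: C_def mem_Collect_eq)
    moreover have "inertia ({#x, y#} + N) > inertia M"
      using midpoint_inner_self_less[OF xy(3)] by (simp add: inertia_def N xy(4))
    ultimately show False using max by fastforce
  qed
  with M show ?thesis unfolding C_def by blast
qed

text \<open>
  By uniqueness of barycentric coordinates \<open>c (\<alpha> i) = k * s i / sum s I\<close>, so \<open>sum s I\<close> divides every
  \<open>k * s i\<close>, hence also their greatest common divisor \<open>k\<close>.
\<close>

lemma integer_affine_representation_dvd:
  fixes \<alpha> :: "'i \<Rightarrow> 'a::euclidean_space" and s :: "'i \<Rightarrow> nat" and c :: "'a \<Rightarrow> int" and k :: nat
  assumes "finite I" "inj_on \<alpha> I" "\<not> affine_dependent (\<alpha> ` I)"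
    and "Gcd (s ` I) = 1" "sum s I > 0"
    and c_sum: "(\<Sum>a\<in>\<alpha> ` I. c a) = int k"
    and c_comb: "(\<Sum>a\<in>\<alpha> ` I. real_of_int (c a) *\<^sub>R a)
      = real k *\<^sub>R (\<Sum>i\<in>I. (real (s i) / real (sum s I)) *\<^sub>R \<alpha> i)"
  shows "sum s I dvd k"
proof -
  define S where "S = sum s I"
  have S: "S > 0" using assms(5) by (simp add: S_def)
  define w where "w a = real (s (inv_into I \<alpha> a)) / real S" for a
  define u where "u a = real_of_int (c a) - real k * w a" for a
  have w: "w (\<alpha> i) = real (s i) / real S" if "i \<in> I" for i
    using assms(2) that by (simp add: w_def)
  have "sum w (\<alpha> ` I) = (\<Sum>i\<in>I. real (s i) / real S)"
    using assms(2) by (simp add: sum.reindex w)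
  also have "\<dots> = 1"
    using S by (simp add: sum_divide_distrib[symmetric] S_def flip: of_nat_sum)
  finally have "sum u (\<alpha> ` I) = 0"
    using c_sum by (simp add: u_def sum_subtractf sum_distrib_left[symmetric] flip: of_int_sum)
  moreover have "(\<Sum>a\<in>\<alpha> ` I. w a *\<^sub>R a) = (\<Sum>i\<in>I. (real (s i) / real S) *\<^sub>R \<alpha> i)"
    using assms(2) by (simp add: sum.reindex w)
  then have "(\<Sum>a\<in>\<alpha> ` I. u a *\<^sub>R a) = 0"
    using c_comb
    by (simp add: u_def scaleR_left_diff_distrib sum_subtractf S_def
        flip: scaleR_scaleR scaleR_right.sum)
  ultimately have u0: "u a = 0" if "a \<in> \<alpha> ` I" for a
    using assms(1,3) that affine_dependent_explicit_finite[of "\<alpha> ` I"] by blast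
  have "S dvd k * s i" if "i \<in> I" for i
  proof -
    have "real_of_int (c (\<alpha> i)) * real S = real k * real (s i)"
      using u0[of "\<alpha> i"] w[OF that] that S by (simp add: u_def field_simps)
    then have "c (\<alpha> i) * int S = int (k * s i)"
      by (metis (mono_tags) of_int_eq_iff of_int_mult of_int_of_nat_eq of_nat_mult)
    then have "int S dvd int (k * s i)"
      by (metis dvd_triv_right)
    then show ?thesis by (simp only: int_dvd_int_iff)
  qed
  then have "S dvd Gcd ((*) k ` (s ` I))"
    by (intro Gcd_greatest) auto
  also have "Gcd ((*) k ` (s ` I)) = k"
    using assms(4) by (simp add: Gcd_mult)
  finally show ?thesis by (simp add: S_def)
qed

theorem theorem11:
  fixes V B :: "'a::euclidean_space set"
    and \<alpha> :: "nat \<Rightarrow> 'a" and \<beta> :: 'a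
    and s :: "nat \<Rightarrow> nat" and m s_hat :: nat
  assumes "inj_on \<alpha> {1..m}"
    and "trellis V (\<alpha> ` {1..m})"
    and "\<And>i. i \<in> {1..m} \<Longrightarrow> s i > 0"
    and "Gcd (s ` {1..m}) = 1"
    and "s_hat = (\<Sum>i=1..m. s i)"
    and "\<beta> = (\<Sum>i=1..m. (real (s i) / real s_hat) *\<^sub>R \<alpha> i)"
    and "point_mediated_set V (\<alpha> ` {1..m}) \<beta> B"
  shows "infinite B \<or> int (card B) \<ge> \<lceil>log 2 (real s_hat)\<rceil>"
proof (cases "finite B")
  case finB: True
  define A where "A = \<alpha> ` {1..m}"
  have finA: "finite A" and indep: "\<not> affine_dependent A"
    using assms(2) by (auto simp: trellis_def A_def)
  have mid: "\<forall>b\<in>B. \<exists>x\<in>A \<union> B. \<exists>y\<in>A \<union> B. x \<noteq> y \<and> b = midpoint x y" and "\<beta> \<in> A \<union> B"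
    using assms(7) by (auto simp: point_mediated_set_def mediated_set_def A_def)
  have "m \<noteq> 0" using assms(4) by (cases m) auto
  then have pos: "s_hat > 0"
    unfolding assms(5) using assms(3) by (intro sum_pos) auto
  obtain M where M: "set_mset (M k) \<subseteq> A \<union> B" "size (M k) = k" "\<Sum>\<^sub># (M k) = real k *\<^sub>R \<beta>"
      "\<forall>b\<in>B. count (M k) b \<le> 1" for k
    using stable_configuration_exists[OF finA finB mid \<open>\<beta> \<in> A \<union> B\<close>] by metis
  define T where "T k = {b \<in> B. b \<in># M k}" for k
  have distinct: "T k \<noteq> T l" if "k < l" "l < s_hat" for k l
  proof
    assume eq: "T k = T l"
    \<comment> \<open>Chips on \<open>B\<close> cancel in the difference, so it lives on \<open>A\<close>. A point in both \<open>A\<close> and \<open>B\<close>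
      counts as a point of \<open>B\<close>.\<close>
    define N where "N j = {#p \<in># M j. p \<notin> B#}" for j
    define D where "D j = {#p \<in># M j. p \<in> B#}" for j
    have split: "M j = D j + N j" for j
      by (simp add: D_def N_def)
    have "count (M j) b = (if b \<in> T j then 1 else 0)" if "b \<in> B" for b j
      using M(4)[of j] that by (auto simp: T_def le_Suc_eq simp flip: count_greater_zero_iff)
    then have "D k = D l"
      by (intro multiset_eqI) (simp add: D_def eq)
    then have size: "size (N k) + l = size (N l) + k"
      and sum: "\<Sum>\<^sub># (N l) - \<Sum>\<^sub># (N k) = real l *\<^sub>R \<beta> - real k *\<^sub>R \<beta>"
      using M(2)[of k] M(2)[of l] M(3)[of k, symmetric] M(3)[of l, symmetric]
      by (simp_all add: split)
    have NA: "set_mset (N j) \<subseteq> A" for j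
      using M(1)[of j] by (auto simp: N_def)
    define c where "c a = int (count (N l) a) - int (count (N k) a)" for a
    have "(\<Sum>a\<in>A. c a) = int (size (N l)) - int (size (N k))"
      by (simp add: c_def sum_subtractf size_eq_sum_count[OF finA NA])
    also have "\<dots> = int (l - k)"
      using size that by simp
    finally have c_sum: "(\<Sum>a\<in>A. c a) = int (l - k)" .
    have "(\<Sum>a\<in>A. real_of_int (c a) *\<^sub>R a) = \<Sum>\<^sub># (N l) - \<Sum>\<^sub># (N k)"
      by (simp add: c_def sum_subtractf scaleR_left_diff_distrib
          sum_mset_scaleR_count[OF finA NA])
    also have "\<dots> = real (l - k) *\<^sub>R \<beta>"
      using sum that by (simp add: of_nat_diff scaleR_left_diff_distrib)
    finally have c_comb: "(\<Sum>a\<in>A. real_of_int (c a) *\<^sub>R a) = real (l - k) *\<^sub>R \<beta>" .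
    have "s_hat dvd l - k"
      using integer_affine_representation_dvd[of "{1..m}" \<alpha> s c "l - k"]
        c_sum c_comb assms(1,4) indep pos
      unfolding assms(6) A_def assms(5) by simp
    then show False using that by (auto dest: dvd_imp_le)
  qed
  then have "inj_on T {..<s_hat}"
    by (intro linorder_inj_onI') auto
  moreover have "T ` {..<s_hat} \<subseteq> Pow B"
    by (auto simp: T_def)
  ultimately have "s_hat \<le> 2 ^ card B"
    using card_inj_on_le[of T "{..<s_hat}" "Pow B"] finB by (simp add: card_Pow)
  then have "real s_hat \<le> 2 ^ card B"
    by (metis of_nat_le_iff of_nat_numeral of_nat_power)
  then have "log 2 (real s_hat) \<le> real (card B)"
    using pos by (simp add: log_le_iff powr_realpow)
  then show ?thesis
    by (simp add: ceiling_le_iff)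
qed simp

end
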